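(* For every fixed integer $r\ge 3$, the maximum number of edges in an $r$-uniform $n$-vertex hypergraph with no trace copy of $C_3^3$ is $\Theta_r(n^2)$; that is, it lies between $c\,n^2$ and $C\,n^2$ for all sufficiently large $n$, where $c,C>0$ depend only on $r$.
   Context: $C_3^3$ is the $3$-uniform loose triangle: the hypergraph with six distinct vertices $x,y,z,a,b,c$ and the three edges $\{x,y,a\}$, $\{x,z,b\}$, $\{y,z,c\}$. A hypergraph $H$ is a finite vertex set $V(H)$ with a set system $E(H)\subseteq\mathcal P(V(H))$; it is $r$-uniform if all edges have size $r$. For $S\subseteq V(H)$, the trace of $H$ on $S$ is the hypergraph on $S$ with edge set $H|_S=\{E\cap S:E\in E(H)\}$. $H$ contains a trace copy of a hypergraph $F$ if $H|_S$ contains a subhypergraph isomorphic to $F$ for some $S\subseteq V(H)$. *)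

theory Defs
  imports Complex_Main
begin

type_synonym 'a hypergraph = "'a set \<times> 'a set set"

abbreviation vertices :: "'a hypergraph \<Rightarrow> 'a set" where
  "vertices H \<equiv> fst H"

abbreviation edges :: "'a hypergraph \<Rightarrow> 'a set set" where
  "edges H \<equiv> snd H"

definition hypergraph :: "'a hypergraph \<Rightarrow> bool" where
  "hypergraph H \<longleftrightarrow> finite (vertices H) \<and> edges H \<subseteq> Pow (vertices H)"

definition uniform :: "nat \<Rightarrow> 'a hypergraph \<Rightarrow> bool" where
  "uniform r H \<longleftrightarrow> (\<forall>e\<in>edges H. card e = r)"

definition trace :: "'a hypergraph \<Rightarrow> 'a set \<Rightarrow> 'a hypergraph" where
  "trace H S = (S, {e \<inter> S | e. e \<in> edges H})"

definition subhypergraph :: "'a hypergraph \<Rightarrow> 'a hypergraph \<Rightarrow> bool" where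
  "subhypergraph H' H \<longleftrightarrow>
     hypergraph H' \<and> vertices H' \<subseteq> vertices H \<and> edges H' \<subseteq> edges H"

definition isomorphic :: "'a hypergraph \<Rightarrow> 'b hypergraph \<Rightarrow> bool" where
  "isomorphic F H \<longleftrightarrow>
     (\<exists>f. bij_betw f (vertices F) (vertices H) \<and> edges H = (\<lambda>e. f ` e) ` edges F)"

definition contains_trace_copy :: "'a hypergraph \<Rightarrow> 'b hypergraph \<Rightarrow> bool" where
  "contains_trace_copy H F \<longleftrightarrow>
     (\<exists>S \<subseteq> vertices H. \<exists>H'. subhypergraph H' (trace H S) \<and> isomorphic F H')"

text \<open>The vertices x, y, z, a, b, c of the loose triangle are 0, ..., 5 in this order.\<close>

definition loose_triangle :: "nat hypergraph" where
  "loose_triangle = ({0, 1, 2, 3, 4, 5}, {{0, 1, 3}, {0, 2, 4}, {1, 2, 5}})"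

text \<open>Vertices may be taken to be natural numbers, since every finite hypergraph is isomorphic
  to one of this kind.\<close>

definition trace_free_sizes :: "nat \<Rightarrow> 'b hypergraph \<Rightarrow> nat \<Rightarrow> nat set" where
  "trace_free_sizes r F n =
     {card (edges H) | H :: nat hypergraph.
        hypergraph H \<and> card (vertices H) = n \<and> uniform r H \<and> \<not> contains_trace_copy H F}"

definition trace_ex :: "nat \<Rightarrow> 'b hypergraph \<Rightarrow> nat \<Rightarrow> nat" where
  "trace_ex r F n = Max (trace_free_sizes r F n)"

text \<open>The maximum is taken over a finite set, which is nonempty as soon as \<open>F\<close> has an edge.\<close>

lemma finite_trace_free_sizes: "finite (trace_free_sizes r F n)"
proof (rule finite_subset)
  show "trace_free_sizes r F n \<subseteq> {..2 ^ n}"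
    unfolding trace_free_sizes_def hypergraph_def
    by (auto simp: card_Pow[symmetric] intro!: card_mono)
qed simp

lemma trace_free_sizes_nonempty:
  assumes "edges F \<noteq> {}"
  shows "trace_free_sizes r F n \<noteq> {}"
proof -
  let ?H = "({..<n}, {}) :: nat hypergraph"
  have "\<not> contains_trace_copy ?H F"
    using assms
    by (auto simp: contains_trace_copy_def subhypergraph_def trace_def isomorphic_def)
  moreover have "hypergraph ?H" "card (vertices ?H) = n" "uniform r ?H"
    by (auto simp: hypergraph_def uniform_def)
  ultimately have "card (edges ?H) \<in> trace_free_sizes r F n"
    unfolding trace_free_sizes_def by blast
  then show ?thesis by blast
qed

end

theory Submission
  imports Defs
begin

text \<open>
  A trace copy of the loose triangle amounts to three edges whose Venn diagram has all six
  non-central regions inhabited: the pairwise regions hold \<open>x\<close>, \<open>y\<close>, \<open>z\<close> and the private ones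
  \<open>a\<close>, \<open>b\<close>, \<open>c\<close> (lemma \<open>contains_trace_loose_triangle_iff\<close>).

  Lower bound. Adjoin all pairs of the remaining vertices to a fixed core of \<open>r - 2\<close> vertices.
  The core lies in the central region, and each edge would need three vertices off the centre
  but has only two off the core.

  Upper bound. Call a set \<open>A\<close> expandable if, for every small set disjoint from \<open>A\<close>, some edge
  through \<open>A\<close> avoids it; this is what the kernel of a large sunflower provides. As in the
  sunflower lemma, a set \<open>p\<close> contained in many edges extends to an expandable proper subset of one
  of them (\<open>expandable_between\<close>). Hence each pair is responsible for boundedly many edges in which
  it lies in no expandable proper subset, and if there are more than \<open>C n\<^sup>2\<close> edges, some edge \<open>E\<close> has
  all its pairs covered by expandable proper subsets of \<open>E\<close>. A minimality argument inside \<open>E\<close>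
  (\<open>triangle_of_pair_cover\<close>) gives points \<open>x\<close>, \<open>y\<close>, \<open>z\<close> and expandable sets meeting \<open>{x, y, z}\<close>
  in each of its three pairs. Edges through these three sets that are otherwise disjoint from
  \<open>E\<close> and from each other form the configuration.
\<close>

section \<open>Trace copies of the loose triangle as Venn diagrams\<close>

definition venn_triangle :: "'a set \<Rightarrow> 'a set \<Rightarrow> 'a set \<Rightarrow> bool" where
  "venn_triangle A B C \<longleftrightarrow>
     A \<inter> B - C \<noteq> {} \<and> A \<inter> C - B \<noteq> {} \<and> B \<inter> C - A \<noteq> {} \<and>
     A - (B \<union> C) \<noteq> {} \<and> B - (A \<union> C) \<noteq> {} \<and> C - (A \<union> B) \<noteq> {}"

lemma venn_triangle_if_contains_trace:
  assumes "contains_trace_copy H loose_triangle"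
  shows "\<exists>A\<in>edges H. \<exists>B\<in>edges H. \<exists>C\<in>edges H. venn_triangle A B C"
proof -
  from assms obtain S H' f where sub: "subhypergraph H' (trace H S)"
    and f: "bij_betw f {0, 1, 2, 3, 4, 5::nat} (vertices H')"
    and E: "edges H' = (\<lambda>e. f ` e) ` {{0, 1, 3}, {0, 2, 4}, {1, 2, 5}}"
    unfolding contains_trace_copy_def isomorphic_def loose_triangle_def by auto
  have S: "f ` {0, 1, 2, 3, 4, 5} \<subseteq> S"
    using sub f by (auto simp: subhypergraph_def trace_def bij_betw_def)
  have tr: "\<exists>D\<in>edges H. f ` e = D \<inter> S" if "e \<in> {{0, 1, 3}, {0, 2, 4}, {1, 2, 5}}" for e
  proof -
    have "f ` e \<in> edges H'"
      unfolding E using that by (rule imageI)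
    then have "f ` e \<in> edges (trace H S)"
      using sub unfolding subhypergraph_def by blast
    then show ?thesis
      by (auto simp: trace_def)
  qed
  obtain A B C where H: "A \<in> edges H" "B \<in> edges H" "C \<in> edges H"
    and A: "f ` {0, 1, 3} = A \<inter> S" and B: "f ` {0, 2, 4} = B \<inter> S" and C: "f ` {1, 2, 5} = C \<inter> S"
    using tr[of "{0, 1, 3}"] tr[of "{0, 2, 4}"] tr[of "{1, 2, 5}"] by blast
  have inj: "inj_on f {0, 1, 2, 3, 4, 5}"
    using f by (simp add: bij_betw_def)
  have mem: "f i \<in> D \<longleftrightarrow> i \<in> I"
    if "f ` I = D \<inter> S" "I \<subseteq> {0, 1, 2, 3, 4, 5}" "i \<in> {0, 1, 2, 3, 4, 5}" for i I D
  proof -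
    have "f i \<in> D \<longleftrightarrow> f i \<in> f ` I"
      using that S by auto
    also have "\<dots> \<longleftrightarrow> i \<in> I"
      using inj that(3,2) by (rule inj_on_image_mem_iff)
    finally show ?thesis .
  qed
  have "f 0 \<in> A \<inter> B - C" "f 1 \<in> A \<inter> C - B" "f 2 \<in> B \<inter> C - A"
    "f 3 \<in> A - (B \<union> C)" "f 4 \<in> B - (A \<union> C)" "f 5 \<in> C - (A \<union> B)"
    by (simp_all add: mem[OF A] mem[OF B] mem[OF C])
  then have "venn_triangle A B C"
    unfolding venn_triangle_def by blast
  with H show ?thesis by blast
qed

lemma contains_trace_if_venn_triangle:
  assumes H: "hypergraph H" "A \<in> edges H" "B \<in> edges H" "C \<in> edges H"
    and "venn_triangle A B C"
  shows "contains_trace_copy H loose_triangle"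
proof -
  from assms(5) obtain x y z a b c
    where xyz: "x \<in> A \<inter> B - C" "y \<in> A \<inter> C - B" "z \<in> B \<inter> C - A"
      and abc: "a \<in> A - (B \<union> C)" "b \<in> B - (A \<union> C)" "c \<in> C - (A \<union> B)"
    unfolding venn_triangle_def by blast
  let ?S = "{x, y, z, a, b, c}"
  let ?H' = "(?S, {{x, y, a}, {x, z, b}, {y, z, c}})"
  define f where "f = (!) [x, y, z, a, b, c]"
  have fs: "f 0 = x" "f 1 = y" "f 2 = z" "f 3 = a" "f 4 = b" "f 5 = c" "f (Suc 0) = y"
    by (simp_all add: f_def)
  have "?S \<subseteq> vertices H"
    using H xyz abc by (auto simp: hypergraph_def)
  moreover have tr: "D \<inter> ?S \<in> edges (trace H ?S)" if "D \<in> edges H" for D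
    using that by (auto simp: trace_def)
  have "A \<inter> ?S = {x, y, a}" "B \<inter> ?S = {x, z, b}" "C \<inter> ?S = {y, z, c}"
    using xyz abc by auto
  then have "{{x, y, a}, {x, z, b}, {y, z, c}} \<subseteq> edges (trace H ?S)"
    using tr[OF H(2)] tr[OF H(3)] tr[OF H(4)] by simp
  then have "subhypergraph ?H' (trace H ?S)"
    by (auto simp: subhypergraph_def hypergraph_def trace_def)
  moreover have "bij_betw f {0, 1, 2, 3, 4, 5} ?S"
    unfolding bij_betw_def using xyz abc by (auto simp: fs)
  then have "isomorphic loose_triangle ?H'"
    unfolding isomorphic_def loose_triangle_def by (intro exI[of _ f]) (auto simp: fs)
  ultimately show ?thesis
    unfolding contains_trace_copy_def by blast
qed

lemma contains_trace_loose_triangle_iff: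
  assumes "hypergraph H"
  shows "contains_trace_copy H loose_triangle \<longleftrightarrow>
    (\<exists>A\<in>edges H. \<exists>B\<in>edges H. \<exists>C\<in>edges H. venn_triangle A B C)"
proof
  assume "\<exists>A\<in>edges H. \<exists>B\<in>edges H. \<exists>C\<in>edges H. venn_triangle A B C"
  then show "contains_trace_copy H loose_triangle"
    by (elim bexE) (rule contains_trace_if_venn_triangle[OF assms])
qed (rule venn_triangle_if_contains_trace)

section \<open>Lower bound\<close>

text \<open>A vertex off the centre is off the common part \<open>K\<close>, so \<open>p\<close> contains the three vertices that
  the edge \<open>K \<union> p\<close> must contribute to non-central regions.\<close>

lemma not_venn_triangle_common_core:
  assumes "card p = 2"
  shows "\<not> venn_triangle (K \<union> p) (K \<union> q) (K \<union> s)"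
proof
  assume "venn_triangle (K \<union> p) (K \<union> q) (K \<union> s)"
  then obtain x y a where "{x, y, a} \<subseteq> p" "x \<noteq> y" "x \<noteq> a" "y \<noteq> a"
    unfolding venn_triangle_def by blast
  moreover have "finite p"
    using assms by (simp add: card_ge_0_finite)
  ultimately have "card {x, y, a} \<le> card p"
    by (intro card_mono)
  with assms \<open>x \<noteq> y\<close> \<open>x \<noteq> a\<close> \<open>y \<noteq> a\<close> show False
    by simp
qed

lemma trace_ex_loose_triangle_ge:
  assumes "2 \<le> r" "r - 2 \<le> n"
  shows "(n - (r - 2)) choose 2 \<le> trace_ex r loose_triangle n"
proof -
  let ?K = "{..<r - 2}"
  let ?P = "{p. p \<subseteq> {r - 2..<n} \<and> card p = 2}"
  let ?H = "({..<n}, (\<union>) ?K ` ?P)"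
  have "inj_on ((\<union>) ?K) ?P"
    by (rule inj_on_inverseI[where g = "\<lambda>e. e - ?K"]) auto
  then have "card (edges ?H) = (n - (r - 2)) choose 2"
    by (simp add: card_image n_subsets)
  moreover have H: "hypergraph ?H"
    using assms by (auto simp: hypergraph_def)
  moreover have "uniform r ?H"
    unfolding uniform_def
  proof
    fix e assume "e \<in> edges ?H"
    then obtain p where p: "p \<subseteq> {r - 2..<n}" "card p = 2" "e = ?K \<union> p"
      by auto
    moreover have "finite p"
      using p by (meson finite_atLeastLessThan finite_subset)
    moreover have "?K \<inter> p = {}"
      using p by auto
    ultimately show "card e = r"
      using assms by (simp add: card_Un_disjoint)
  qed
  moreover have "\<not> contains_trace_copy ?H loose_triangle"
    unfolding contains_trace_loose_triangle_iff[OF H]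
    by (auto simp: not_venn_triangle_common_core)
  ultimately have "(n - (r - 2)) choose 2 \<in> trace_free_sizes r loose_triangle n"
    unfolding trace_free_sizes_def
    by (intro CollectI exI[of _ ?H]) auto
  then show ?thesis
    unfolding trace_ex_def by (intro Max_ge finite_trace_free_sizes)
qed

section \<open>Expandable sets\<close>

definition expandable :: "nat \<Rightarrow> 'a set set \<Rightarrow> 'a set \<Rightarrow> bool" where
  "expandable m F A \<longleftrightarrow>
     (\<forall>T. finite T \<and> card T \<le> m \<and> A \<inter> T = {} \<longrightarrow> (\<exists>D\<in>F. A \<subseteq> D \<and> D \<inter> T = {}))"

lemma expandable_mono: "expandable m F A \<Longrightarrow> F \<subseteq> G \<Longrightarrow> expandable m G A"
  unfolding expandable_def by (meson subsetD)

text \<open>This is the greedy argument of the sunflower lemma. If \<open>p\<close> is not expandable, at most \<open>m\<close>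
  points outside \<open>p\<close> meet all members of \<open>F\<close>, so one of these points lies in at least a fraction
  \<open>1 / m\<close> of them and can be added to \<open>p\<close>. Since \<open>m ^ 0 = 1\<close>, the process stops before \<open>p\<close> grows
  into a member of \<open>F\<close>.\<close>

lemma expandable_between:
  assumes "finite F" "finite p"
    and "\<And>D. D \<in> F \<Longrightarrow> p \<subseteq> D \<and> finite D \<and> card D = card p + k"
    and "card F > m ^ k"
  shows "\<exists>D\<in>F. \<exists>A. p \<subseteq> A \<and> A \<subset> D \<and> expandable m F A"
  using assms
proof (induction k arbitrary: p F)
  case 0
  have "D = p" if "D \<in> F" for D
    using "0.prems"(3)[OF that] card_subset_eq[of D p] by simp
  then have "F \<subseteq> {p}" by blast
  then have "card F \<le> 1"
    using card_mono[of "{p}" F] by simp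
  with 0 show ?case by simp
next
  case (Suc k)
  show ?case
  proof (cases "expandable m F p")
    case True
    obtain D where "D \<in> F"
      using Suc.prems(4) by fastforce
    moreover have "p \<noteq> D"
      using Suc.prems(3)[OF \<open>D \<in> F\<close>] by auto
    ultimately show ?thesis
      using True Suc.prems(3)[of D] by blast
  next
    case False
    then obtain T where T: "finite T" "card T \<le> m" "p \<inter> T = {}"
      and "\<not> (\<exists>D\<in>F. p \<subseteq> D \<and> D \<inter> T = {})"
      unfolding expandable_def by blast
    then have meet: "D \<inter> T \<noteq> {}" if "D \<in> F" for D
      using Suc.prems(3)[OF that] that by blast
    let ?G = "\<lambda>t. {D \<in> F. t \<in> D}"
    have "\<exists>t\<in>T. card (?G t) > m ^ k"
    proof (rule ccontr)
      assume small: "\<not> (\<exists>t\<in>T. card (?G t) > m ^ k)"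
      have "F \<subseteq> (\<Union>t\<in>T. ?G t)"
        using meet by blast
      then have "card F \<le> card (\<Union>t\<in>T. ?G t)"
        using T(1) Suc.prems(1) by (intro card_mono) auto
      also have "\<dots> \<le> (\<Sum>t\<in>T. card (?G t))"
        by (rule card_UN_le[OF T(1)])
      also have "\<dots> \<le> card T * m ^ k"
        using small sum_bounded_above[of T "\<lambda>t. card (?G t)" "m ^ k"] by (simp add: not_less)
      also have "\<dots> \<le> m ^ Suc k"
        using T(2) by simp
      finally show False
        using Suc.prems(4) by simp
    qed
    then obtain t where t: "t \<in> T" "card (?G t) > m ^ k" ..
    have "t \<notin> p"
      using t T by blast
    have "\<exists>D\<in>?G t. \<exists>A. insert t p \<subseteq> A \<and> A \<subset> D \<and> expandable m (?G t) A"
    proof (rule Suc.IH)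
      show "insert t p \<subseteq> D \<and> finite D \<and> card D = card (insert t p) + k" if "D \<in> ?G t" for D
        using that Suc.prems(2) Suc.prems(3)[of D] \<open>t \<notin> p\<close> by simp
    qed (use Suc.prems(1,2) t(2) in auto)
    then obtain D A where "D \<in> F" "insert t p \<subseteq> A" "A \<subset> D" and A: "expandable m (?G t) A"
      by blast
    moreover have "expandable m F A"
      using A by (rule expandable_mono) blast
    ultimately show ?thesis
      by (meson insert_subset)
  qed
qed

section \<open>Upper bound\<close>

text \<open>Take a pair \<open>{x, y}\<close> for which the family of all members of \<open>\<K>\<close> through it is minimal, and
  \<open>z\<close> outside some member \<open>A\<close> of that family. If every member through \<open>{x, z}\<close> contained \<open>y\<close>, these
  members would form a subfamily missing \<open>A\<close>, against minimality; likewise for \<open>{y, z}\<close>.\<close>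

lemma triangle_of_pair_cover:
  assumes fin: "finite E" and pair: "\<exists>x\<in>E. \<exists>y\<in>E. x \<noteq> y"
    and proper: "\<And>A. A \<in> \<K> \<Longrightarrow> A \<subset> E"
    and cover: "\<And>x y. x \<in> E \<Longrightarrow> y \<in> E \<Longrightarrow> x \<noteq> y \<Longrightarrow> \<exists>A\<in>\<K>. {x, y} \<subseteq> A"
  shows "\<exists>x y z. \<exists>A\<in>\<K>. \<exists>B\<in>\<K>. \<exists>C\<in>\<K>.
    x \<in> A \<inter> B - C \<and> y \<in> A \<inter> C - B \<and> z \<in> B \<inter> C - A"
proof -
  define through where "through x y = {A \<in> \<K>. {x, y} \<subseteq> A}" for x y
  have "finite \<K>"
    using fin proper by (intro finite_subset[of \<K> "Pow E"]) auto
  then have fin_through: "finite (through x y)" for x y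
    by (simp add: through_def)
  define pairs where "pairs = {(u, v). u \<in> E \<and> v \<in> E \<and> u \<noteq> v}"
  obtain q where q: "q \<in> pairs"
    and least: "\<And>q'. q' \<in> pairs \<Longrightarrow> card (case_prod through q) \<le> card (case_prod through q')"
  proof -
    obtain q0 where "q0 \<in> pairs"
      using pair by (auto simp: pairs_def)
    from ex_has_least_nat[of "\<lambda>q. q \<in> pairs", OF this, of "\<lambda>q. card (case_prod through q)"]
    show ?thesis
      using that by blast
  qed
  obtain x y where q_eq: "q = (x, y)" by fastforce
  with q have xy: "x \<in> E" "y \<in> E" "x \<noteq> y"
    by (simp_all add: pairs_def)
  have minimal: "\<not> through u v \<subset> through x y" if "u \<in> E" "v \<in> E" "u \<noteq> v" for u v
    using least[of "(u, v)"] that psubset_card_mono[OF fin_through, of "through u v" x y]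
    by (auto simp: q_eq pairs_def)
  obtain A where A: "A \<in> \<K>" "{x, y} \<subseteq> A"
    using cover xy by blast
  obtain z where z: "z \<in> E" "z \<notin> A"
    using proper[OF A(1)] by blast
  have "A \<in> through x y" "A \<notin> through x z" "A \<notin> through y z"
    using A z by (auto simp: through_def)
  moreover have "x \<noteq> z" "y \<noteq> z"
    using A z by auto
  ultimately have "\<not> through x z \<subseteq> through x y" "\<not> through y z \<subseteq> through x y"
    using minimal[of x z] minimal[of y z] xy z by blast+
  then obtain B C where "B \<in> \<K>" "{x, z} \<subseteq> B" "y \<notin> B" "C \<in> \<K>" "{y, z} \<subseteq> C" "x \<notin> C"
    by (auto simp: through_def)
  moreover from this A z have "x \<in> A \<inter> B - C" "y \<in> A \<inter> C - B" "z \<in> B \<inter> C - A"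
    by simp_all
  ultimately show ?thesis
    using A(1) by meson
qed

text \<open>The three edges are chosen one after another, each avoiding all earlier ones and \<open>E\<close> outside its
  own prescribed part. Its private vertex exists because that part has fewer than \<open>r\<close> elements. The
  last edge has to avoid the most vertices, at most \<open>3 * r\<close>: those of \<open>E\<close> and of two earlier edges.\<close>

lemma venn_triangle_of_expandable:
  assumes unif: "\<And>D. D \<in> F \<Longrightarrow> finite D \<and> card D = r" and "E \<in> F"
    and sub: "A \<subset> E" "B \<subset> E" "C \<subset> E"
    and exp: "expandable (3 * r) F A" "expandable (3 * r) F B" "expandable (3 * r) F C"
    and xyz: "x \<in> A \<inter> B - C" "y \<in> A \<inter> C - B" "z \<in> B \<inter> C - A"
  shows "\<exists>A\<in>F. \<exists>B\<in>F. \<exists>C\<in>F. venn_triangle A B C"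
proof -
  have E: "finite E" "card E = r"
    using unif \<open>E \<in> F\<close> by auto
  have extend: "\<exists>D\<in>F. D \<inter> T = K \<and> D - T \<noteq> {}"
    if K: "expandable (3 * r) F K" "K \<subset> E" and T: "E \<subseteq> T" "finite T" "card T \<le> 3 * r" for K T
  proof -
    have "card (T - K) \<le> 3 * r"
      using T(2,3) by (meson Diff_subset card_mono le_trans)
    then obtain D where D: "D \<in> F" "K \<subseteq> D" "D \<inter> (T - K) = {}"
      using K(1) T(2) unfolding expandable_def by (metis Diff_disjoint finite_Diff)
    then have DT: "D \<inter> T = K"
      using K(2) T(1) by blast
    have "K \<noteq> D"
      using psubset_card_mono[OF E(1) K(2)] unif[OF D(1)] E by auto
    then have "D - T \<noteq> {}"
      using D(2) DT by blast
    with D(1) DT show ?thesis by blast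
  qed
  obtain P where P: "P \<in> F" "P \<inter> E = A" "P - E \<noteq> {}"
    using extend[OF exp(1) sub(1), of E] E by auto
  have EP: "finite (E \<union> P)" "card (E \<union> P) \<le> 2 * r"
    using E unif[OF P(1)] card_Un_le[of E P] by auto
  obtain Q where Q: "Q \<in> F" "Q \<inter> (E \<union> P) = B" "Q - (E \<union> P) \<noteq> {}"
    using extend[OF exp(2) sub(2), of "E \<union> P"] EP by auto
  have EPQ: "finite (E \<union> P \<union> Q)" "card (E \<union> P \<union> Q) \<le> 3 * r"
    using EP unif[OF Q(1)] card_Un_le[of "E \<union> P" Q] by auto
  obtain R where R: "R \<in> F" "R \<inter> (E \<union> P \<union> Q) = C" "R - (E \<union> P \<union> Q) \<noteq> {}"
    using extend[OF exp(3) sub(3), of "E \<union> P \<union> Q"] EPQ by auto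
  have "x \<in> P \<inter> Q - R" "y \<in> P \<inter> R - Q" "z \<in> Q \<inter> R - P"
    using xyz sub P(2) Q(2) R(2) by blast+
  moreover have "P - (Q \<union> R) \<noteq> {}" "Q - (P \<union> R) \<noteq> {}" "R - (P \<union> Q) \<noteq> {}"
    using sub P(2,3) Q(2,3) R(2,3) by blast+
  ultimately have "venn_triangle P Q R"
    unfolding venn_triangle_def by blast
  with P(1) Q(1) R(1) show ?thesis by blast
qed

lemma card_edges_le_if_trace_free:
  assumes H: "hypergraph H" "uniform r H" and "2 \<le> r"
    and free: "\<not> contains_trace_copy H loose_triangle"
  shows "card (edges H) \<le> (3 * r) ^ (r - 2) * card (vertices H) ^ 2"
proof -
  let ?V = "vertices H" and ?F = "edges H" and ?m = "3 * r"
  let ?pairs = "{(x, y) \<in> ?V \<times> ?V. x \<noteq> y}"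
  define \<K> where "\<K> E = {A. A \<subset> E \<and> expandable ?m ?F A}" for E
  define bad where "bad = (\<lambda>(x, y). {E \<in> ?F. {x, y} \<subseteq> E \<and> \<not> (\<exists>A\<in>\<K> E. {x, y} \<subseteq> A)})"
  have bad_sub: "bad q \<subseteq> ?F" for q
    by (cases q) (auto simp: bad_def)
  have finV: "finite ?V" and finF: "finite ?F"
    using H(1) by (auto simp: hypergraph_def intro: finite_subset)
  have unif: "finite D \<and> card D = r" if "D \<in> ?F" for D
    using H that finV by (auto simp: hypergraph_def uniform_def intro: finite_subset)
  have "?F \<subseteq> (\<Union>q\<in>?pairs. bad q)"
  proof (rule ccontr)
    assume "\<not> ?F \<subseteq> (\<Union>q\<in>?pairs. bad q)"
    then obtain E where E: "E \<in> ?F" and good: "\<And>q. q \<in> ?pairs \<Longrightarrow> E \<notin> bad q"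
      by blast
    have "E \<subseteq> ?V"
      using H(1) E by (auto simp: hypergraph_def)
    then have cover: "\<exists>A\<in>\<K> E. {x, y} \<subseteq> A" if "x \<in> E" "y \<in> E" "x \<noteq> y" for x y
      using good[of "(x, y)"] E that by (auto simp: bad_def)
    have "\<not> is_singleton E" "E \<noteq> {}"
      using unif[OF E] \<open>2 \<le> r\<close> by (auto simp: is_singleton_altdef)
    then have pair: "\<exists>x\<in>E. \<exists>y\<in>E. x \<noteq> y"
      by (metis is_singletonI')
    have "\<exists>x y z. \<exists>A\<in>\<K> E. \<exists>B\<in>\<K> E. \<exists>C\<in>\<K> E.
        x \<in> A \<inter> B - C \<and> y \<in> A \<inter> C - B \<and> z \<in> B \<inter> C - A"
      by (rule triangle_of_pair_cover[OF _ pair _ cover]) (use unif[OF E] in \<open>auto simp: \<K>_def\<close>)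
    then obtain x y z A B C where ABC: "A \<in> \<K> E" "B \<in> \<K> E" "C \<in> \<K> E"
      and xyz: "x \<in> A \<inter> B - C" "y \<in> A \<inter> C - B" "z \<in> B \<inter> C - A"
      by (elim exE bexE conjE)
    have "\<exists>A\<in>?F. \<exists>B\<in>?F. \<exists>C\<in>?F. venn_triangle A B C"
      by (rule venn_triangle_of_expandable[OF unif E _ _ _ _ _ _ xyz])
        (use ABC in \<open>simp_all add: \<K>_def\<close>)
    with free show False
      by (simp add: contains_trace_loose_triangle_iff[OF H(1)])
  qed
  then have "card ?F \<le> card (\<Union>q\<in>?pairs. bad q)"
    using finF bad_sub by (intro card_mono finite_subset[of "\<Union>q\<in>?pairs. bad q" ?F]) blast+
  also have "\<dots> \<le> (\<Sum>q\<in>?pairs. card (bad q))"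
    using finV by (intro card_UN_le finite_subset[of ?pairs "?V \<times> ?V"]) auto
  also have "\<dots> \<le> (\<Sum>q\<in>?pairs. ?m ^ (r - 2))"
  proof (rule sum_mono)
    fix q assume "q \<in> ?pairs"
    then obtain x y where q: "q = (x, y)" "x \<noteq> y" by blast
    show "card (bad q) \<le> ?m ^ (r - 2)"
    proof (rule ccontr)
      assume "\<not> card (bad q) \<le> ?m ^ (r - 2)"
      then have large: "card (bad q) > ?m ^ (r - 2)" by simp
      have "\<exists>D\<in>bad q. \<exists>A. {x, y} \<subseteq> A \<and> A \<subset> D \<and> expandable ?m (bad q) A"
      proof (rule expandable_between[OF _ _ _ large])
        show "finite (bad q)"
          using bad_sub finF by (rule finite_subset)
        show "{x, y} \<subseteq> D \<and> finite D \<and> card D = card {x, y} + (r - 2)" if "D \<in> bad q" for D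
          using that q unif[of D] \<open>2 \<le> r\<close> by (auto simp: bad_def)
      qed simp
      then obtain D A where "D \<in> bad q" "{x, y} \<subseteq> A" "A \<subset> D" "expandable ?m ?F A"
        using expandable_mono[OF _ bad_sub] by blast
      then show False
        by (auto simp: bad_def \<K>_def q)
    qed
  qed
  also have "\<dots> = card ?pairs * ?m ^ (r - 2)"
    by simp
  also have "\<dots> \<le> card (?V \<times> ?V) * ?m ^ (r - 2)"
    using finV by (intro mult_right_mono card_mono) auto
  also have "\<dots> = ?m ^ (r - 2) * card ?V ^ 2"
    by (simp add: card_cartesian_product power2_eq_square)
  finally show ?thesis .
qed

lemma trace_ex_loose_triangle_le:
  assumes "2 \<le> r"
  shows "trace_ex r loose_triangle n \<le> (3 * r) ^ (r - 2) * n ^ 2"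
proof -
  have "trace_ex r loose_triangle n \<in> trace_free_sizes r loose_triangle n"
    unfolding trace_ex_def
    by (intro Max_in finite_trace_free_sizes trace_free_sizes_nonempty)
      (simp add: loose_triangle_def)
  then show ?thesis
    using card_edges_le_if_trace_free[OF _ _ assms]
    by (auto simp: trace_free_sizes_def)
qed

section \<open>The order of magnitude\<close>

theorem theorem1p4:
  fixes r :: nat
  assumes "r \<ge> 3"
  shows "\<exists>c C :: real. c > 0 \<and> C > 0 \<and>
    (\<forall>\<^sub>F n in sequentially.
       c * real n ^ 2 \<le> real (trace_ex r loose_triangle n) \<and>
       real (trace_ex r loose_triangle n) \<le> C * real n ^ 2)"
proof (rule exI[of _ "1 / 8"], rule exI[of _ "real ((3 * r) ^ (r - 2))"], intro conjI)
  show "(1 / 8 :: real) > 0"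
    by simp
  show "real ((3 * r) ^ (r - 2)) > 0"
    using assms by simp
  show "\<forall>\<^sub>F n in sequentially.
       1 / 8 * real n ^ 2 \<le> real (trace_ex r loose_triangle n) \<and>
       real (trace_ex r loose_triangle n) \<le> real ((3 * r) ^ (r - 2)) * real n ^ 2"
    using eventually_ge_at_top[of "2 * r"]
  proof eventually_elim
    case (elim n)
    \<comment> \<open>For \<open>n \<ge> 2 * r\<close> at least half of the vertices lie off the core, whence the constant \<open>1 / 8\<close>.\<close>
    define k where "k = n - (r - 2)"
    have k: "real n / 2 \<le> real k - 1"
      using elim assms unfolding k_def by linarith
    then have "(real n / 2) * (real n / 2) \<le> real k * (real k - 1)"
      by (intro mult_mono) auto
    moreover have "real (k choose 2) = real k * (real k - 1) / 2"
      by (simp add: binomial_gbinomial gbinomial_prod_rev numeral_2_eq_2)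
    ultimately have "1 / 8 * real n ^ 2 \<le> real (k choose 2)"
      by (simp add: power2_eq_square)
    moreover have "k choose 2 \<le> trace_ex r loose_triangle n"
      unfolding k_def using elim assms by (intro trace_ex_loose_triangle_ge) auto
    moreover have "trace_ex r loose_triangle n \<le> (3 * r) ^ (r - 2) * n ^ 2"
      using assms by (intro trace_ex_loose_triangle_le) simp
    then have "real (trace_ex r loose_triangle n) \<le> real ((3 * r) ^ (r - 2) * n ^ 2)"
      by (simp only: of_nat_le_iff)
    ultimately show ?case
      by simp
  qed
qed

end
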